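(* Let $(\mathcal{N},G)$ be a Riemannian manifold with metric $G$ and norm $\|v\|:=\sqrt{G(v,v)}$, let $U\subset\mathcal{N}$ be a convex subset of $\mathcal{N}$, and let $f:U\to\mathbb{R}$ be a function possessing a Riemannian gradient $\mathrm{grad} f$ and a Riemannian Hessian $\mathrm{Hess} f$. Say that $\mathrm{Hess} f$ satisfies the Lipschitz condition at $x\in U$ if there is a constant $L<\infty$ such that $$\|\mathcal{P}_{1,0}\,\mathrm{Hess} f(\exp_x(\Delta x))\,\mathcal{P}_{0,1}-\mathrm{Hess} f(x)\|\le L\|\Delta x\|\qquad\text{for all }\Delta x\in T_x\mathcal{N}\text{ with }\exp_x(\Delta x)\in U ,$$ where $\mathcal{P}_{\alpha,\beta}:T_{\gamma(\alpha)}\mathcal{N}\to T_{\gamma(\beta)}\mathcal{N}$ denotes parallel transport along the geodesic $\gamma(t)=\exp_x(t\Delta x)$, $t\in[0,1]$. Assume that this Lipschitz condition holds at the point $\hat{x}\in U$ considered below. Then: (a) If $\hat{x}$ is an optimal solution (of minimizing $f$), then $\mathrm{Hess} f(\hat{x})\ge0$, i.e. $G(\mathrm{Hess} f(\hat{x})h,h)\ge0$ for all $h\in T_{\hat{x}}\mathcal{N}$. (b) If $\hat{x}$ satisfies $\mathrm{grad} f(\hat{x})=0$ and $\mathrm{Hess} f(\hat{x})$ is coercive, i.e. $G(\mathrm{Hess} f(\hat{x})h,h)\ge c\|h\|^2$ for all $h\in T_{\hat{x}}\mathcal{N}$ and some $c>0$, then $\hat{x}$ is a local minimum of $f$, provided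 that $\mathrm{Hess} f(\hat{x})$ satisfies the Lipschitz condition above.
   Context: $\mathrm{Hess} f(x):T_x\mathcal{N}\to T_x\mathcal{N}$ is the Riemannian Hessian, $\mathrm{Hess} f(x)[v]:=\nabla_v\,\mathrm{grad} f$, where $\nabla$ is the Riemannian (Levi-Civita) connection of $G$ and $\mathrm{grad} f$ is the Riemannian gradient. The norm of a linear operator on a tangent space is the operator norm induced by $\|\cdot\|$. $\exp$ is the Riemannian exponential map. Convexity is meant in the geodesic sense: for $x,\exp_x(\Delta x)\in U$ the geodesic $t\mapsto\exp_x(t\Delta x)$, $t\in[0,1]$, lies in $U$.
   Formalization: The convex set U is additionally assumed open: the gradient and Hessian of f: U→ℝ on the full tangent space are undefined at non-interior points, and with one-sided derivatives (a) fails, e.g. f(x)=x−x² on [0,1/2] at 0. *)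

theory Defs
  imports "HOL-Analysis.Analysis"
begin

section \<open>Manifolds\<close>

text \<open>Manifolds are modelled on a real Hilbert space \<open>'e\<close>. Every type of class
  \<open>euclidean_space\<close> is an instance, which is the finite-dimensional case. A chart is a pair of
  its domain and its coordinate map; the values of the map outside the domain are irrelevant.\<close>

type_synonym ('m, 'e) chart = "'m set \<times> ('m \<Rightarrow> 'e)"

abbreviation chart_inv :: "('m, 'e) chart \<Rightarrow> 'e \<Rightarrow> 'm" where
  "chart_inv c \<equiv> inv_into (fst c) (snd c)"

abbreviation chart_image :: "('m, 'e) chart \<Rightarrow> 'e set" where
  "chart_image c \<equiv> snd c ` fst c"

text \<open>A tangent vector at \<open>x\<close> is the family of its components with respect to all charts at \<open>x\<close>
  (see \<open>tangent_space\<close> below).\<close>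

type_synonym ('m, 'e) tvec = "('m, 'e) chart \<Rightarrow> 'e"

record ('m, 'e) riemannian =
  mtop :: "'m topology"
  atlas :: "('m, 'e) chart set"
  metric :: "'m \<Rightarrow> ('m, 'e) tvec \<Rightarrow> ('m, 'e) tvec \<Rightarrow> real"

text \<open>\<open>Ck_on k S f\<close> is meant for open \<open>S\<close>. In finite dimension it is the usual class
  \<open>C\<^sup>k\<close>. In infinite dimension the directional derivatives express a weaker condition for a single
  \<open>k\<close>, but by the uniform boundedness principle the condition for all \<open>k\<close> is again the usual
  smoothness with respect to the operator norm.\<close>

primrec Ck_on :: "nat \<Rightarrow> 'a::real_normed_vector set \<Rightarrow> ('a \<Rightarrow> 'b::real_normed_vector) \<Rightarrow> bool" where
  "Ck_on 0 S f \<longleftrightarrow> continuous_on S f"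
| "Ck_on (Suc k) S f \<longleftrightarrow> (\<forall>x\<in>S. f differentiable (at x)) \<and>
     (\<forall>v. Ck_on k S (\<lambda>x. frechet_derivative f (at x) v))"

definition smooth_on :: "'a::real_normed_vector set \<Rightarrow> ('a \<Rightarrow> 'b::real_normed_vector) \<Rightarrow> bool" where
  "smooth_on S f \<longleftrightarrow> (\<forall>k. Ck_on k S f)"

definition transition :: "('m, 'e) chart \<Rightarrow> ('m, 'e) chart \<Rightarrow> 'e \<Rightarrow> 'e" where
  "transition c d = snd d \<circ> chart_inv c"

text \<open>Neither maximality of the atlas nor second countability is required.\<close>

definition smooth_manifold :: "('m, 'e::{real_inner, complete_space}) riemannian \<Rightarrow> bool" where
  "smooth_manifold N \<longleftrightarrow>
     Hausdorff_space (mtop N) \<and>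
     topspace (mtop N) = (\<Union>c\<in>atlas N. fst c) \<and>
     (\<forall>c\<in>atlas N. openin (mtop N) (fst c) \<and> open (chart_image c) \<and>
        homeomorphic_map (subtopology (mtop N) (fst c)) (top_of_set (chart_image c)) (snd c)) \<and>
     (\<forall>c\<in>atlas N. \<forall>d\<in>atlas N. smooth_on (snd c ` (fst c \<inter> fst d)) (transition c d))"

definition charts_at :: "('m, 'e) riemannian \<Rightarrow> 'm \<Rightarrow> ('m, 'e) chart set" where
  "charts_at N x = {c \<in> atlas N. x \<in> fst c}"

text \<open>The value \<open>0\<close> for charts whose domain does not contain \<open>x\<close> makes the representation of a
  tangent vector unique.\<close>

definition tangent_space ::
    "('m, 'e::{real_inner, complete_space}) riemannian \<Rightarrow> 'm \<Rightarrow> ('m, 'e) tvec set" where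
  "tangent_space N x = {\<xi>.
     (\<forall>c\<in>charts_at N x. \<forall>d\<in>charts_at N x.
        \<xi> d = frechet_derivative (transition c d) (at (snd c x)) (\<xi> c)) \<and>
     (\<forall>c. c \<notin> charts_at N x \<longrightarrow> \<xi> c = 0)}"

definition tzero :: "('m, 'e::real_vector) tvec" where
  "tzero = (\<lambda>c. 0)"

definition tscale :: "real \<Rightarrow> ('m, 'e::real_vector) tvec \<Rightarrow> ('m, 'e) tvec" where
  "tscale t \<xi> = (\<lambda>c. t *\<^sub>R \<xi> c)"

definition tdiff :: "('m, 'e::real_vector) tvec \<Rightarrow> ('m, 'e) tvec \<Rightarrow> ('m, 'e) tvec" where
  "tdiff \<xi> \<eta> = (\<lambda>c. \<xi> c - \<eta> c)"

text \<open>The tangent vector at \<open>x\<close> whose component in the chart \<open>c\<close> is \<open>u\<close>.\<close>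

definition tangent_of ::
    "('m, 'e::{real_inner, complete_space}) riemannian \<Rightarrow> ('m, 'e) chart \<Rightarrow> 'm \<Rightarrow> 'e \<Rightarrow> ('m, 'e) tvec" where
  "tangent_of N c x u = (\<lambda>d. if d \<in> charts_at N x
     then frechet_derivative (transition c d) (at (snd c x)) u else 0)"


section \<open>Riemannian metrics\<close>

definition metric_in ::
    "('m, 'e::{real_inner, complete_space}) riemannian \<Rightarrow> ('m, 'e) chart \<Rightarrow> 'e \<Rightarrow> 'e \<Rightarrow> 'e \<Rightarrow> real" where
  "metric_in N c y u v =
     metric N (chart_inv c y) (tangent_of N c (chart_inv c y) u) (tangent_of N c (chart_inv c y) v)"

text \<open>The last line of the pointwise condition says that the inner product on the tangent space
  induces its topology; in finite dimension this is the same as positive definiteness.\<close>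

definition riemannian_manifold :: "('m, 'e::{real_inner, complete_space}) riemannian \<Rightarrow> bool" where
  "riemannian_manifold N \<longleftrightarrow>
     smooth_manifold N \<and>
     (\<forall>c\<in>atlas N.
        (\<forall>y\<in>chart_image c.
           bounded_bilinear (metric_in N c y) \<and>
           (\<forall>u v. metric_in N c y u v = metric_in N c y v u) \<and>
           (\<exists>k>0. \<forall>u. k * (norm u)\<^sup>2 \<le> metric_in N c y u u)) \<and>
        smooth_on (chart_image c) (\<lambda>y. Blinfun (\<lambda>u. Blinfun (metric_in N c y u))))"

definition tnorm :: "('m, 'e) riemannian \<Rightarrow> 'm \<Rightarrow> ('m, 'e) tvec \<Rightarrow> real" where
  "tnorm N x \<xi> = sqrt (metric N x \<xi> \<xi>)"

text \<open>Extended real values make the supremum meaningful for unbounded operators as well.\<close>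

definition op_norm ::
    "('m, 'e::{real_inner, complete_space}) riemannian \<Rightarrow> 'm \<Rightarrow>
     (('m, 'e) tvec \<Rightarrow> ('m, 'e) tvec) \<Rightarrow> ereal" where
  "op_norm N x A = (SUP \<xi>\<in>{\<xi> \<in> tangent_space N x. tnorm N x \<xi> \<le> 1}. ereal (tnorm N x (A \<xi>)))"


section \<open>The Levi-Civita connection\<close>

text \<open>A connection is given by its Christoffel maps: in the chart \<open>c\<close> the covariant derivative of a
  vector field \<open>X\<close> in direction \<open>v\<close> at the coordinate point \<open>y\<close> is \<open>DX(y) v + \<Gamma> c y v X(y)\<close>.\<close>

type_synonym ('m, 'e) christoffel = "('m, 'e) chart \<Rightarrow> 'e \<Rightarrow> 'e \<Rightarrow> 'e \<Rightarrow> 'e"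

text \<open>The three conditions are tensoriality in both arguments, vanishing torsion, and compatibility
  with the metric, tested on vector fields with constant components \<open>u\<close> and \<open>v\<close>. They determine
  \<open>\<Gamma> c y\<close> (lemma below), so the transformation law under change of charts need not be required.\<close>

definition levi_civita ::
    "('m, 'e::{real_inner, complete_space}) riemannian \<Rightarrow> ('m, 'e) christoffel \<Rightarrow> bool" where
  "levi_civita N \<Gamma> \<longleftrightarrow> (\<forall>c\<in>atlas N. \<forall>y\<in>chart_image c.
     bounded_bilinear (\<Gamma> c y) \<and>
     (\<forall>u v. \<Gamma> c y u v = \<Gamma> c y v u) \<and>
     (\<forall>w u v. frechet_derivative (\<lambda>z. metric_in N c z u v) (at y) w =
        metric_in N c y (\<Gamma> c y w u) v + metric_in N c y u (\<Gamma> c y w v)))"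

lemma levi_civita_unique:
  assumes N: "riemannian_manifold N" and 1: "levi_civita N \<Gamma>" and 2: "levi_civita N \<Gamma>'"
    and c: "c \<in> atlas N" and y: "y \<in> chart_image c"
  shows "\<Gamma> c y = \<Gamma>' c y"
proof (intro ext)
  fix a b
  let ?g = "metric_in N c y"
  have bil: "bounded_bilinear ?g" and sym: "\<And>u v. ?g u v = ?g v u"
    using N c y unfolding riemannian_manifold_def by blast+
  obtain k where k: "k > 0" "\<And>u. k * (norm u)\<^sup>2 \<le> ?g u u"
    using N c y unfolding riemannian_manifold_def by blast
  define S where "S w u v = ?g (\<Gamma> c y w u - \<Gamma>' c y w u) v" for w u v
  have s: "S w u v = S u w v" for w u v
    using 1 2 c y unfolding levi_civita_def S_def by metis
  have t: "S w u v = - S w v u" for w u v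
  proof -
    have "?g (\<Gamma> c y w u) v + ?g u (\<Gamma> c y w v) = ?g (\<Gamma>' c y w u) v + ?g u (\<Gamma>' c y w v)"
      using 1 2 c y unfolding levi_civita_def by metis
    then show ?thesis
      unfolding S_def bounded_bilinear.diff_left[OF bil]
      using sym[of u "\<Gamma> c y w v"] sym[of u "\<Gamma>' c y w v"] by linarith
  qed
  have "S w u v = 0" for w u v
    using s[of w u v] s[of w v u] s[of u v w] t[of w u v] t[of u w v] t[of v w u] by linarith
  then have "?g (\<Gamma> c y a b - \<Gamma>' c y a b) (\<Gamma> c y a b - \<Gamma>' c y a b) = 0"
    unfolding S_def by blast
  then have "k * (norm (\<Gamma> c y a b - \<Gamma>' c y a b))\<^sup>2 \<le> 0"
    using k(2) by metis
  then show "\<Gamma> c y a b = \<Gamma>' c y a b"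
    using k(1) by (simp add: mult_le_0_iff)
qed

definition vfield_differentiable ::
    "('m, 'e::{real_inner, complete_space}) riemannian \<Rightarrow> ('m \<Rightarrow> ('m, 'e) tvec) \<Rightarrow> 'm \<Rightarrow> bool" where
  "vfield_differentiable N X x \<longleftrightarrow>
     (\<forall>c\<in>charts_at N x. (\<lambda>y. X (chart_inv c y) c) differentiable (at (snd c x)))"

definition nabla ::
    "('m, 'e::{real_inner, complete_space}) riemannian \<Rightarrow> ('m, 'e) christoffel \<Rightarrow>
     ('m \<Rightarrow> ('m, 'e) tvec) \<Rightarrow> 'm \<Rightarrow> ('m, 'e) tvec \<Rightarrow> ('m, 'e) tvec" where
  "nabla N \<Gamma> X x v = (\<lambda>c. if c \<in> charts_at N x
     then frechet_derivative (\<lambda>y. X (chart_inv c y) c) (at (snd c x)) (v c)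
          + \<Gamma> c (snd c x) (v c) (X x c)
     else 0)"


section \<open>Parallel transport, geodesics and the exponential map\<close>

definition velocity ::
    "('m, 'e::{real_inner, complete_space}) riemannian \<Rightarrow> (real \<Rightarrow> 'm) \<Rightarrow> real \<Rightarrow> ('m, 'e) tvec" where
  "velocity N \<gamma> t = (\<lambda>c. if c \<in> charts_at N (\<gamma> t)
     then vector_derivative (snd c \<circ> \<gamma>) (at t within {0..1}) else 0)"

definition differentiable_curve ::
    "('m, 'e::{real_inner, complete_space}) riemannian \<Rightarrow> (real \<Rightarrow> 'm) \<Rightarrow> bool" where
  "differentiable_curve N \<gamma> \<longleftrightarrow>
     continuous_map (top_of_set {0..1}) (mtop N) \<gamma> \<and>
     (\<forall>t\<in>{0..1}. \<forall>c\<in>charts_at N (\<gamma> t). (snd c \<circ> \<gamma>) differentiable (at t within {0..1}))"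

text \<open>\<open>V\<close> is a parallel vector field along \<open>\<gamma>\<close>: its covariant derivative
  \<open>V' + \<Gamma>(\<gamma>', V)\<close> along the curve vanishes.\<close>

definition parallel_along ::
    "('m, 'e::{real_inner, complete_space}) riemannian \<Rightarrow> ('m, 'e) christoffel \<Rightarrow> (real \<Rightarrow> 'm) \<Rightarrow>
     (real \<Rightarrow> ('m, 'e) tvec) \<Rightarrow> bool" where
  "parallel_along N \<Gamma> \<gamma> V \<longleftrightarrow>
     differentiable_curve N \<gamma> \<and>
     (\<forall>t\<in>{0..1}. V t \<in> tangent_space N (\<gamma> t) \<and>
        (\<forall>c\<in>charts_at N (\<gamma> t).
           ((\<lambda>s. V s c) has_vector_derivative - \<Gamma> c (snd c (\<gamma> t)) (velocity N \<gamma> t c) (V t c))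
             (at t within {0..1})))"

definition parallel_transport ::
    "('m, 'e::{real_inner, complete_space}) riemannian \<Rightarrow> ('m, 'e) christoffel \<Rightarrow> (real \<Rightarrow> 'm) \<Rightarrow>
     real \<Rightarrow> real \<Rightarrow> ('m, 'e) tvec \<Rightarrow> ('m, 'e) tvec" where
  "parallel_transport N \<Gamma> \<gamma> \<alpha> \<beta> \<xi> =
     (THE \<eta>. \<exists>V. parallel_along N \<Gamma> \<gamma> V \<and> V \<alpha> = \<xi> \<and> V \<beta> = \<eta>)"

definition geodesic ::
    "('m, 'e::{real_inner, complete_space}) riemannian \<Rightarrow> ('m, 'e) christoffel \<Rightarrow> (real \<Rightarrow> 'm) \<Rightarrow> bool" where
  "geodesic N \<Gamma> \<gamma> \<longleftrightarrow> parallel_along N \<Gamma> \<gamma> (velocity N \<gamma>)"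

text \<open>The manifold need not be geodesically complete, so the exponential map is partial:
  \<open>exp_dom N \<Gamma> x\<close> consists of the tangent vectors whose geodesic exists on \<open>[0,1]\<close>.\<close>

definition exp_dom ::
    "('m, 'e::{real_inner, complete_space}) riemannian \<Rightarrow> ('m, 'e) christoffel \<Rightarrow> 'm \<Rightarrow> ('m, 'e) tvec set" where
  "exp_dom N \<Gamma> x =
     {\<xi> \<in> tangent_space N x. \<exists>\<gamma>. geodesic N \<Gamma> \<gamma> \<and> \<gamma> 0 = x \<and> velocity N \<gamma> 0 = \<xi>}"

definition riem_exp ::
    "('m, 'e::{real_inner, complete_space}) riemannian \<Rightarrow> ('m, 'e) christoffel \<Rightarrow> 'm \<Rightarrow> ('m, 'e) tvec \<Rightarrow> 'm" where
  "riem_exp N \<Gamma> x \<xi> =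
     (THE p. \<exists>\<gamma>. geodesic N \<Gamma> \<gamma> \<and> \<gamma> 0 = x \<and> velocity N \<gamma> 0 = \<xi> \<and> \<gamma> 1 = p)"

definition geodesically_convex ::
    "('m, 'e::{real_inner, complete_space}) riemannian \<Rightarrow> ('m, 'e) christoffel \<Rightarrow> 'm set \<Rightarrow> bool" where
  "geodesically_convex N \<Gamma> U \<longleftrightarrow>
     U \<subseteq> topspace (mtop N) \<and>
     (\<forall>x\<in>U. \<forall>\<xi>\<in>exp_dom N \<Gamma> x. riem_exp N \<Gamma> x \<xi> \<in> U \<longrightarrow>
        (\<forall>t\<in>{0..1}. riem_exp N \<Gamma> x (tscale t \<xi>) \<in> U))"


section \<open>Gradient and Hessian\<close>

text \<open>Only the germ of \<open>f\<close> at \<open>x\<close> matters, so for \<open>x\<close> in an open set \<open>U\<close> the values of \<open>f\<close>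
  outside \<open>U\<close> are irrelevant.\<close>

definition has_gradient ::
    "('m, 'e::{real_inner, complete_space}) riemannian \<Rightarrow> ('m \<Rightarrow> real) \<Rightarrow> 'm \<Rightarrow> ('m, 'e) tvec \<Rightarrow> bool" where
  "has_gradient N f x \<xi> \<longleftrightarrow>
     \<xi> \<in> tangent_space N x \<and>
     (\<forall>c\<in>charts_at N x.
        ((f \<circ> chart_inv c) has_derivative (\<lambda>u. metric N x \<xi> (tangent_of N c x u))) (at (snd c x)))"

definition grad ::
    "('m, 'e::{real_inner, complete_space}) riemannian \<Rightarrow> ('m \<Rightarrow> real) \<Rightarrow> 'm \<Rightarrow> ('m, 'e) tvec" where
  "grad N f x = (THE \<xi>. has_gradient N f x \<xi>)"

definition Hess ::
    "('m, 'e::{real_inner, complete_space}) riemannian \<Rightarrow> ('m, 'e) christoffel \<Rightarrow> ('m \<Rightarrow> real) \<Rightarrow> 'm \<Rightarrow>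
     ('m, 'e) tvec \<Rightarrow> ('m, 'e) tvec" where
  "Hess N \<Gamma> f x v = nabla N \<Gamma> (grad N f) x v"

definition has_grad_and_Hess_on ::
    "('m, 'e::{real_inner, complete_space}) riemannian \<Rightarrow> ('m \<Rightarrow> real) \<Rightarrow> 'm set \<Rightarrow> bool" where
  "has_grad_and_Hess_on N f U \<longleftrightarrow>
     (\<forall>x\<in>U. (\<exists>\<xi>. has_gradient N f x \<xi>) \<and> vfield_differentiable N (grad N f) x)"

definition Hess_lipschitz_at ::
    "('m, 'e::{real_inner, complete_space}) riemannian \<Rightarrow> ('m, 'e) christoffel \<Rightarrow> ('m \<Rightarrow> real) \<Rightarrow>
     'm set \<Rightarrow> 'm \<Rightarrow> bool" where
  "Hess_lipschitz_at N \<Gamma> f U x \<longleftrightarrow>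
     (\<exists>L::real. \<forall>\<xi>\<in>exp_dom N \<Gamma> x. riem_exp N \<Gamma> x \<xi> \<in> U \<longrightarrow>
        (let P = parallel_transport N \<Gamma> (\<lambda>t. riem_exp N \<Gamma> x (tscale t \<xi>)) in
         op_norm N x (\<lambda>\<eta>. tdiff (P 1 0 (Hess N \<Gamma> f (riem_exp N \<Gamma> x \<xi>) (P 0 1 \<eta>))) (Hess N \<Gamma> f x \<eta>))
           \<le> ereal (L * tnorm N x \<xi>)))"


section \<open>Minimizers\<close>

definition optimal_solution :: "('m \<Rightarrow> real) \<Rightarrow> 'm set \<Rightarrow> 'm \<Rightarrow> bool" where
  "optimal_solution f U x \<longleftrightarrow> x \<in> U \<and> (\<forall>y\<in>U. f x \<le> f y)"

definition local_minimum :: "('m, 'e) riemannian \<Rightarrow> ('m \<Rightarrow> real) \<Rightarrow> 'm set \<Rightarrow> 'm \<Rightarrow> bool" where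
  "local_minimum N f U x \<longleftrightarrow>
     x \<in> U \<and> (\<exists>W. openin (mtop N) W \<and> x \<in> W \<and> (\<forall>y\<in>W \<inter> U. f x \<le> f y))"

end

theory Submission
  imports Defs
begin

text \<open>In a chart at a critical point the differential of \<open>f\<close> is \<open>u \<mapsto> g\<^sub>y(X(y), u)\<close>, where the
  gradient field \<open>X\<close> is Frechet differentiable and vanishes at the point. Hence \<open>f\<close> has a
  second-order Taylor expansion there, with quadratic term \<open>G(Hess f h, h) / 2\<close> and a remainder
  \<open>o(\<parallel>h\<parallel>\<^sup>2)\<close> that is uniform in the direction of \<open>h\<close>; the Christoffel term of the Hessian
  drops out because \<open>X = 0\<close>. Both second-order conditions then follow as in a Hilbert space.\<close>

section \<open>Charts and tangent spaces\<close>

lemma openin_chart_domain: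
  assumes "smooth_manifold N" "c \<in> atlas N"
  shows "openin (mtop N) (fst c)"
  using assms unfolding smooth_manifold_def by blast

lemma homeomorphic_map_chart:
  assumes "smooth_manifold N" "c \<in> atlas N"
  shows "homeomorphic_map (subtopology (mtop N) (fst c)) (top_of_set (chart_image c)) (snd c)"
  using assms unfolding smooth_manifold_def by blast

lemma inj_on_chart:
  assumes "smooth_manifold N" "c \<in> atlas N"
  shows "inj_on (snd c) (fst c)"
  using homeomorphic_imp_injective_map[OF homeomorphic_map_chart[OF assms]]
    openin_subset[OF openin_chart_domain[OF assms]]
  by (simp add: Int_absorb1 Int_absorb2)

lemma open_chart_image_Int:
  assumes "smooth_manifold N" "c \<in> atlas N" "openin (mtop N) W"
  shows "open (snd c ` (fst c \<inter> W))"
proof -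
  have "openin (subtopology (mtop N) (fst c)) (fst c \<inter> W)"
    using assms(3) by (auto simp: openin_subtopology)
  then have "openin (top_of_set (chart_image c)) (snd c ` (fst c \<inter> W))"
    using homeomorphic_imp_open_map[OF homeomorphic_map_chart[OF assms(1,2)]]
    unfolding open_map_def by blast
  moreover have "open (chart_image c)"
    using assms(1,2) unfolding smooth_manifold_def by blast
  ultimately show ?thesis
    by (rule openin_open_trans)
qed

lemma openin_chart_vimage:
  assumes "smooth_manifold N" "c \<in> atlas N" "open B"
  shows "openin (mtop N) {x \<in> fst c. snd c x \<in> B}"
proof -
  have "continuous_map (subtopology (mtop N) (fst c)) (top_of_set (chart_image c)) (snd c)"
    using homeomorphic_map_chart[OF assms(1,2)] by (rule homeomorphic_imp_continuous_map)
  then have "openin (subtopology (mtop N) (fst c))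
      {x \<in> topspace (subtopology (mtop N) (fst c)). snd c x \<in> chart_image c \<inter> B}"
    using assms(3) by (intro openin_continuous_map_preimage) (auto simp: openin_open)
  also have "{x \<in> topspace (subtopology (mtop N) (fst c)). snd c x \<in> chart_image c \<inter> B}
      = {x \<in> fst c. snd c x \<in> B}"
    using openin_subset[OF openin_chart_domain[OF assms(1,2)]] by auto
  finally show ?thesis
    using openin_chart_domain[OF assms(1,2)] openin_trans_full by blast
qed

lemma chart_inv_chart:
  assumes "smooth_manifold N" "c \<in> charts_at N x"
  shows "chart_inv c (snd c x) = x"
  using assms inj_on_chart[of N c] by (auto simp: charts_at_def)

lemma transition_apply:
  assumes "smooth_manifold N" "c \<in> charts_at N x"
  shows "transition c d (snd c x) = snd d x"
  using chart_inv_chart[OF assms] by (simp add: transition_def)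

lemma smooth_on_differentiable:
  "smooth_on S \<phi> \<Longrightarrow> x \<in> S \<Longrightarrow> \<phi> differentiable (at x)"
  unfolding smooth_on_def by (metis Ck_on.simps(2))

lemma smooth_on_continuous_derivative:
  "smooth_on S \<phi> \<Longrightarrow> continuous_on S (\<lambda>x. frechet_derivative \<phi> (at x) v)"
  unfolding smooth_on_def by (metis Ck_on.simps)

lemma smooth_on_transition:
  assumes "smooth_manifold N" "c \<in> charts_at N x" "d \<in> charts_at N x"
  shows "smooth_on (snd c ` (fst c \<inter> fst d)) (transition c d)"
    and "open (snd c ` (fst c \<inter> fst d))" and "snd c x \<in> snd c ` (fst c \<inter> fst d)"
  using assms open_chart_image_Int[of N c "fst d"] openin_chart_domain[of N d]
  unfolding smooth_manifold_def charts_at_def by auto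

lemma transition_has_derivative:
  assumes "smooth_manifold N" "c \<in> charts_at N x" "d \<in> charts_at N x"
  shows "(transition c d has_derivative frechet_derivative (transition c d) (at (snd c x))) (at (snd c x))"
  using smooth_on_differentiable[OF smooth_on_transition(1,3)[OF assms]]
  by (simp add: frechet_derivative_works)

lemma transition_derivative_comp:
  assumes N: "smooth_manifold N"
    and c: "c \<in> charts_at N x" and d: "d \<in> charts_at N x" and e: "e \<in> charts_at N x"
  shows "frechet_derivative (transition c e) (at (snd c x)) u =
    frechet_derivative (transition d e) (at (snd d x))
      (frechet_derivative (transition c d) (at (snd c x)) u)"
proof -
  let ?S = "snd c ` (fst c \<inter> (fst d \<inter> fst e))"
  have "open ?S"
    using c d e by (intro open_chart_image_Int[OF N] openin_Int openin_chart_domain[OF N])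
      (auto simp: charts_at_def)
  moreover have "snd c x \<in> ?S"
    using c d e by (auto simp: charts_at_def)
  moreover have "(transition d e \<circ> transition c d) y = transition c e y" if y: "y \<in> ?S" for y
  proof -
    obtain p where p: "p \<in> fst c" "p \<in> fst d" "p \<in> fst e" "y = snd c p"
      using y by blast
    then have "c \<in> charts_at N p" "d \<in> charts_at N p"
      using c d by (auto simp: charts_at_def)
    then show ?thesis
      using p(4) transition_apply[OF N] by simp
  qed
  moreover have "(transition d e \<circ> transition c d has_derivative
      frechet_derivative (transition d e) (at (snd d x)) \<circ>
      frechet_derivative (transition c d) (at (snd c x))) (at (snd c x))"
    using transition_has_derivative[OF N d e] transition_apply[OF N c, of d]
    by (intro diff_chain_at transition_has_derivative[OF N c d]) simp
  ultimately have "(transition c e has_derivative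
      frechet_derivative (transition d e) (at (snd d x)) \<circ>
      frechet_derivative (transition c d) (at (snd c x))) (at (snd c x))"
    by (rule has_derivative_transform_within_open[rotated])
  from frechet_derivative_at[OF this] show ?thesis
    by (metis comp_apply)
qed

lemma transition_derivative_self:
  assumes N: "smooth_manifold N" and c: "c \<in> charts_at N x"
  shows "frechet_derivative (transition c c) (at (snd c x)) u = u"
proof -
  have id: "y = transition c c y" if "y \<in> snd c ` (fst c \<inter> fst c)" for y
    using that by (auto simp: transition_def f_inv_into_f)
  then have "(transition c c has_derivative (\<lambda>u. u)) (at (snd c x))"
    using smooth_on_transition(2,3)[OF N c c]
    by (intro has_derivative_transform_within_open[OF has_derivative_ident _ _ id]) simp_all
  from frechet_derivative_at[OF this] show ?thesis
    by metis
qed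

lemma tangent_of_component:
  assumes "smooth_manifold N" "c \<in> charts_at N x"
  shows "tangent_of N c x u c = u"
  using assms by (simp add: tangent_of_def transition_derivative_self)

lemma tangent_of_in_tangent_space:
  assumes "smooth_manifold N" "c \<in> charts_at N x"
  shows "tangent_of N c x u \<in> tangent_space N x"
proof -
  have "tangent_of N c x u e = frechet_derivative (transition d e) (at (snd d x)) (tangent_of N c x u d)"
    if "d \<in> charts_at N x" "e \<in> charts_at N x" for d e
    using that by (simp add: tangent_of_def transition_derivative_comp[OF assms that, symmetric])
  moreover have "tangent_of N c x u e = 0" if "e \<notin> charts_at N x" for e
    using that by (simp add: tangent_of_def)
  ultimately show ?thesis
    unfolding tangent_space_def by blast
qed

lemma tangent_of_eq:
  assumes "\<xi> \<in> tangent_space N x" "c \<in> charts_at N x"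
  shows "tangent_of N c x (\<xi> c) = \<xi>"
proof
  fix d
  show "tangent_of N c x (\<xi> c) d = \<xi> d"
  proof (cases "d \<in> charts_at N x")
    case True
    with assms have "\<xi> d = frechet_derivative (transition c d) (at (snd c x)) (\<xi> c)"
      unfolding tangent_space_def by blast
    with True show ?thesis
      unfolding tangent_of_def by simp
  next
    case False
    with assms(1) have "\<xi> d = 0"
      unfolding tangent_space_def by blast
    with False show ?thesis
      by (simp add: tangent_of_def)
  qed
qed

lemma tangent_of_change_chart:
  assumes "smooth_manifold N" "c \<in> charts_at N x" "d \<in> charts_at N x"
  shows "tangent_of N d x (frechet_derivative (transition c d) (at (snd c x)) u) = tangent_of N c x u"
  using assms by (auto simp: tangent_of_def transition_derivative_comp[of N c x d, symmetric])

lemma tangent_of_zero: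
  assumes "smooth_manifold N" "c \<in> charts_at N x"
  shows "tangent_of N c x 0 = tzero"
  using transition_has_derivative[OF assms]
  by (auto simp: tangent_of_def tzero_def has_derivative_def linear_0 bounded_linear.linear)

lemma metric_in_chart:
  assumes "smooth_manifold N" "c \<in> charts_at N x"
  shows "metric_in N c (snd c x) u v = metric N x (tangent_of N c x u) (tangent_of N c x v)"
  using chart_inv_chart[OF assms] by (simp add: metric_in_def)

lemma metric_in_tangent_space:
  assumes "smooth_manifold N" "c \<in> charts_at N x" "\<xi> \<in> tangent_space N x" "\<eta> \<in> tangent_space N x"
  shows "metric_in N c (snd c x) (\<xi> c) (\<eta> c) = metric N x \<xi> \<eta>"
  using assms by (simp add: metric_in_chart tangent_of_eq)

definition metric_blinfun ::
    "('m, 'e::{real_inner, complete_space}) riemannian \<Rightarrow> ('m, 'e) chart \<Rightarrow> 'e \<Rightarrow> 'e \<Rightarrow>\<^sub>L 'e \<Rightarrow>\<^sub>L real" where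
  "metric_blinfun N c y = Blinfun (\<lambda>u. Blinfun (metric_in N c y u))"

lemma metric_blinfun_apply:
  assumes "riemannian_manifold N" "c \<in> atlas N" "y \<in> chart_image c"
  shows "metric_blinfun N c y u v = metric_in N c y u v"
proof -
  have bil: "bounded_bilinear (metric_in N c y)"
    using assms unfolding riemannian_manifold_def by blast
  have "bounded_linear (\<lambda>u. Blinfun (metric_in N c y u))"
  proof -
    obtain K where K: "\<And>u v. norm (metric_in N c y u v) \<le> norm u * norm v * K"  "K \<ge> 0"
      using bounded_bilinear.nonneg_bounded[OF bil] by blast
    note app = bounded_linear_Blinfun_apply[OF bounded_bilinear.bounded_linear_right[OF bil]]
    show ?thesis
    proof (rule bounded_linear_intro[where K = K])
      show "norm (Blinfun (metric_in N c y u)) \<le> norm u * K" for u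
        using K(1)[of u] K(2) by (intro norm_blinfun_bound) (simp_all add: app algebra_simps)
    qed (auto intro!: blinfun_eqI simp: app plus_blinfun.rep_eq scaleR_blinfun.rep_eq
        bounded_bilinear.add_left[OF bil] bounded_bilinear.scaleR_left[OF bil])
  qed
  then show ?thesis
    by (simp add: metric_blinfun_def bounded_linear_Blinfun_apply
        bounded_bilinear.bounded_linear_right[OF bil])
qed

lemma isCont_metric_blinfun:
  assumes "riemannian_manifold N" "c \<in> atlas N" "y \<in> chart_image c"
  shows "isCont (metric_blinfun N c) y"
proof -
  have "smooth_on (chart_image c) (metric_blinfun N c)"
    using assms unfolding riemannian_manifold_def metric_blinfun_def by blast
  from smooth_on_differentiable[OF this assms(3)] show ?thesis
    by (rule differentiable_imp_continuous_within)
qed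

lemma metric_in_nondegenerate:
  assumes "riemannian_manifold N" "c \<in> atlas N" "y \<in> chart_image c"
    and "\<And>v. metric_in N c y u v = metric_in N c y u' v"
  shows "u = u'"
proof -
  obtain k where k: "k > 0" "\<And>u. k * (norm u)\<^sup>2 \<le> metric_in N c y u u"
    using assms(1-3) unfolding riemannian_manifold_def by blast
  have "bounded_bilinear (metric_in N c y)"
    using assms(1-3) unfolding riemannian_manifold_def by blast
  then have "metric_in N c y (u - u') (u - u') = 0"
    using assms(4) by (simp add: bounded_bilinear.diff_left)
  with k(2)[of "u - u'"] k(1) show ?thesis
    by (simp add: mult_le_0_iff)
qed

lemma has_gradient_grad:
  assumes R: "riemannian_manifold N" and x: "x \<in> topspace (mtop N)" and g: "has_gradient N f x \<xi>"
  shows "has_gradient N f x (grad N f x)"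
proof -
  have N: "smooth_manifold N"
    using R unfolding riemannian_manifold_def by blast
  obtain c where c: "c \<in> charts_at N x"
    using x N unfolding smooth_manifold_def charts_at_def by auto
  have "\<eta> = \<xi>" if h: "has_gradient N f x \<eta>" for \<eta>
  proof -
    have T: "\<xi> \<in> tangent_space N x" "\<eta> \<in> tangent_space N x"
      using g h unfolding has_gradient_def by auto
    have "(\<lambda>u. metric N x \<eta> (tangent_of N c x u)) = (\<lambda>u. metric N x \<xi> (tangent_of N c x u))"
      using g h c unfolding has_gradient_def by (blast intro: has_derivative_unique)
    then have "metric_in N c (snd c x) (\<eta> c) u = metric_in N c (snd c x) (\<xi> c) u" for u
      using metric_in_chart[OF N c] T by (metis tangent_of_eq c)
    then have "\<eta> c = \<xi> c"
      using c by (intro metric_in_nondegenerate[OF R]) (auto simp: charts_at_def)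
    then show ?thesis
      using T by (metis tangent_of_eq c)
  qed
  then show ?thesis
    unfolding grad_def using g by (metis theI)
qed

section \<open>Taylor expansion\<close>

lemma directional_limit:
  fixes \<phi> :: "'a::real_normed_vector \<Rightarrow> 'b::real_normed_vector"
  assumes "(\<phi> has_derivative D) (at a)" "\<phi> a = 0"
  shows "((\<lambda>s. \<phi> (a + s *\<^sub>R h) /\<^sub>R s) \<longlongrightarrow> D h) (at 0)"
proof -
  have "((\<lambda>s. a + s *\<^sub>R h) has_derivative (\<lambda>s. s *\<^sub>R h)) (at 0)"
    by (auto intro!: derivative_eq_intros)
  then have "((\<lambda>s. \<phi> (a + s *\<^sub>R h)) has_derivative (\<lambda>s. D (s *\<^sub>R h))) (at 0)"
    using has_derivative_compose[of "\<lambda>s. a + s *\<^sub>R h" _ 0 UNIV \<phi> D] assms(1) by simp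
  then have "((\<lambda>s. norm (\<phi> (a + s *\<^sub>R h) - D (s *\<^sub>R h)) / norm s) \<longlongrightarrow> 0) (at 0)"
    using assms(2) by (simp add: has_derivative_iff_norm)
  then have "((\<lambda>s. norm (\<phi> (a + s *\<^sub>R h) /\<^sub>R s - D h)) \<longlongrightarrow> 0) (at 0)"
  proof (rule Lim_transform_eventually)
    have "norm (\<phi> (a + s *\<^sub>R h) - D (s *\<^sub>R h)) / norm s = norm (\<phi> (a + s *\<^sub>R h) /\<^sub>R s - D h)"
      if "s \<noteq> 0" for s
    proof -
      have "\<phi> (a + s *\<^sub>R h) /\<^sub>R s - D h = (\<phi> (a + s *\<^sub>R h) - D (s *\<^sub>R h)) /\<^sub>R s"
        using that linear_cmul[OF has_derivative_linear[OF assms(1)]]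
        by (simp add: scaleR_diff_right)
      then show ?thesis
        by (simp add: divide_inverse mult.commute)
    qed
    then show "\<forall>\<^sub>F s in at 0. norm (\<phi> (a + s *\<^sub>R h) - D (s *\<^sub>R h)) / norm s =
        norm (\<phi> (a + s *\<^sub>R h) /\<^sub>R s - D h)"
      by (simp add: eventually_at_filter)
  qed
  then show ?thesis
    by (simp add: tendsto_norm_zero_iff LIM_zero_iff)
qed

lemma second_order_expansion:
  fixes F :: "'a::real_normed_vector \<Rightarrow> real" and A :: "'a \<Rightarrow> 'a \<Rightarrow>\<^sub>L real"
  assumes S: "open S" "y\<^sub>0 \<in> S"
    and F: "\<And>y. y \<in> S \<Longrightarrow> (F has_derivative A y) (at y)"
    and A: "(A has_derivative B) (at y\<^sub>0)" and e: "e > 0"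
  shows "\<exists>\<delta>>0. \<forall>h. norm h < \<delta> \<longrightarrow> y\<^sub>0 + h \<in> S \<and>
    \<bar>F (y\<^sub>0 + h) - F y\<^sub>0 - A y\<^sub>0 h - B h h / 2\<bar> \<le> e * (norm h)\<^sup>2"
proof -
  obtain r where r: "r > 0" "ball y\<^sub>0 r \<subseteq> S"
    using S open_contains_ball by blast
  have B: "bounded_linear B"
    using A by (rule has_derivative_bounded_linear)
  obtain d where d: "d > 0"
      "\<And>y. norm (y - y\<^sub>0) < d \<Longrightarrow> norm (A y - A y\<^sub>0 - B (y - y\<^sub>0)) \<le> e * norm (y - y\<^sub>0)"
    using A e unfolding has_derivative_at_alt by blast
  show ?thesis
  proof (intro exI[of _ "min r d"] conjI allI impI)
    show "min r d > 0"
      using r d by simp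
    fix h :: 'a
    assume h: "norm h < min r d"
    have le: "norm (t *\<^sub>R h) \<le> norm h" if "0 \<le> t" "t \<le> 1" for t
      using that by (simp add: mult_left_le_one_le)
    have in_S: "y\<^sub>0 + t *\<^sub>R h \<in> S" if "0 \<le> t" "t \<le> 1" for t
      using le[OF that] h r(2) by (auto simp: dist_norm)
    from in_S[of 1] show "y\<^sub>0 + h \<in> S"
      by simp
    define \<phi> where "\<phi> t = F (y\<^sub>0 + t *\<^sub>R h) - t * A y\<^sub>0 h - t\<^sup>2 / 2 * B h h" for t
    have \<phi>: "(\<phi> has_real_derivative A (y\<^sub>0 + t *\<^sub>R h) h - A y\<^sub>0 h - t * B h h) (at t)"
      if "0 \<le> t" "t \<le> 1" for t
    proof -
      have "((\<lambda>t. y\<^sub>0 + t *\<^sub>R h) has_derivative (\<lambda>s. s *\<^sub>R h)) (at t)"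
        by (auto intro!: derivative_eq_intros)
      from has_derivative_compose[OF this F[OF in_S[OF that]]]
      have "((\<lambda>t. F (y\<^sub>0 + t *\<^sub>R h)) has_real_derivative A (y\<^sub>0 + t *\<^sub>R h) h) (at t)"
        by (simp add: has_field_derivative_def blinfun.scaleR_right mult_commute_abs)
      then show ?thesis
        unfolding \<phi>_def by (auto intro!: derivative_eq_intros)
    qed
    obtain t where t: "0 < t" "t < 1"
        "\<phi> 1 - \<phi> 0 = (1 - 0) * (A (y\<^sub>0 + t *\<^sub>R h) h - A y\<^sub>0 h - t * B h h)"
      using MVT2[of 0 1 \<phi>, OF _ \<phi>] by auto
    have "\<phi> 1 - \<phi> 0 = (A (y\<^sub>0 + t *\<^sub>R h) - A y\<^sub>0 - B (t *\<^sub>R h)) h"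
      using t(3) by (simp add: blinfun.diff_left blinfun.scaleR_left linear_cmul[OF bounded_linear.linear[OF B]])
    also have "\<bar>\<dots>\<bar> \<le> norm (A (y\<^sub>0 + t *\<^sub>R h) - A y\<^sub>0 - B (t *\<^sub>R h)) * norm h"
      using norm_blinfun by (metis real_norm_def)
    also have "\<dots> \<le> (e * norm (t *\<^sub>R h)) * norm h"
      using d(2)[of "y\<^sub>0 + t *\<^sub>R h"] le[of t] t h by (intro mult_right_mono) auto
    also have "\<dots> \<le> (e * norm h) * norm h"
      using le[of t] t e by (intro mult_right_mono mult_left_mono) auto
    finally show "\<bar>F (y\<^sub>0 + h) - F y\<^sub>0 - A y\<^sub>0 h - B h h / 2\<bar> \<le> e * (norm h)\<^sup>2"
      by (simp add: \<phi>_def power2_eq_square mult.assoc)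
  qed
qed

section \<open>Gradient and Hessian at critical points\<close>

lemma gradient_in_chart:
  assumes R: "riemannian_manifold N" and U: "openin (mtop N) U" and f: "has_grad_and_Hess_on N f U"
    and p: "p \<in> U" and c: "c \<in> charts_at N p"
  shows "((f \<circ> chart_inv c) has_derivative metric_blinfun N c (snd c p) (grad N f p c)) (at (snd c p))"
    and "grad N f p \<in> tangent_space N p"
proof -
  have N: "smooth_manifold N"
    using R unfolding riemannian_manifold_def by blast
  have g: "has_gradient N f p (grad N f p)"
    using f p U openin_subset[OF U] unfolding has_grad_and_Hess_on_def
    by (blast intro: has_gradient_grad[OF R])
  then show T: "grad N f p \<in> tangent_space N p"
    unfolding has_gradient_def by blast
  have "metric_blinfun N c (snd c p) (grad N f p c) u = metric N p (grad N f p) (tangent_of N c p u)" for u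
    using c metric_blinfun_apply[OF R, of c "snd c p"] metric_in_chart[OF N c] tangent_of_eq[OF T c]
    by (auto simp: charts_at_def)
  then have "blinfun_apply (metric_blinfun N c (snd c p) (grad N f p c)) =
      (\<lambda>u. metric N p (grad N f p) (tangent_of N c p u))"
    by (rule ext)
  then show "((f \<circ> chart_inv c) has_derivative metric_blinfun N c (snd c p) (grad N f p c)) (at (snd c p))"
    using g c unfolding has_gradient_def by metis
qed

lemma gradient_field_has_derivative:
  assumes "has_grad_and_Hess_on N f U" "p \<in> U" "c \<in> charts_at N p"
  shows "((\<lambda>y. grad N f (chart_inv c y) c) has_derivative
    frechet_derivative (\<lambda>y. grad N f (chart_inv c y) c) (at (snd c p))) (at (snd c p))"
  using assms unfolding has_grad_and_Hess_on_def vfield_differentiable_def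
  by (auto simp: frechet_derivative_works)

lemma Hess_component:
  assumes "levi_civita N \<Gamma>" "c \<in> charts_at N p" "grad N f p = tzero"
  shows "Hess N \<Gamma> f p h c = frechet_derivative (\<lambda>y. grad N f (chart_inv c y) c) (at (snd c p)) (h c)"
proof -
  have "bounded_bilinear (\<Gamma> c (snd c p))"
    using assms(1,2) unfolding levi_civita_def charts_at_def by blast
  then show ?thesis
    using assms(2,3) by (simp add: Hess_def nabla_def tzero_def bounded_bilinear.zero_right)
qed

lemma metric_in_change_chart:
  assumes "smooth_manifold N" "c \<in> charts_at N p" "d \<in> charts_at N p"
  shows "metric_in N d (snd d p) (frechet_derivative (transition c d) (at (snd c p)) u)
      (frechet_derivative (transition c d) (at (snd c p)) v) = metric_in N c (snd c p) u v"
  using assms by (simp add: metric_in_chart tangent_of_change_chart)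

text \<open>The transformation law for the gradient field is differentiated in its weak form, paired with
  a fixed vector \<open>u\<close>. This only needs pointwise continuity of the derivative of the transition
  map, whereas \<^const>\<open>Ck_on\<close> does not directly provide continuity in operator norm.\<close>

lemma gradient_derivative_change_chart:
  assumes R: "riemannian_manifold N" and U: "openin (mtop N) U" and f: "has_grad_and_Hess_on N f U"
    and p: "p \<in> U" and crit: "grad N f p = tzero"
    and c: "c \<in> charts_at N p" and d: "d \<in> charts_at N p"
  defines "\<tau>' \<equiv> frechet_derivative (transition c d) (at (snd c p))"
    and "D \<equiv> \<lambda>c. frechet_derivative (\<lambda>y. grad N f (chart_inv c y) c) (at (snd c p))"
  shows "D d (\<tau>' h) = \<tau>' (D c h)"
proof -
  have N: "smooth_manifold N"
    using R unfolding riemannian_manifold_def by blast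
  have at: "c \<in> atlas N" "d \<in> atlas N" and im: "snd c p \<in> chart_image c" "snd d p \<in> chart_image d"
    using c d by (auto simp: charts_at_def)
  have weak: "metric_in N d (snd d p) (D d (\<tau>' h)) (\<tau>' u) = metric_in N c (snd c p) (D c h) u" for u
  proof -
    let ?S = "snd c ` (fst c \<inter> (fst d \<inter> U))"
    define y where "y s = snd c p + s *\<^sub>R h" for s :: real
    define X where "X c y = grad N f (chart_inv c y) c" for c y
    have X_p: "X c (snd c p) = 0" "X d (snd d p) = 0"
      using crit by (simp_all add: X_def chart_inv_chart[OF N c] chart_inv_chart[OF N d] tzero_def)
    have DX: "(X c has_derivative D c) (at (snd c p))" "(X d has_derivative D d) (at (snd d p))"
      unfolding X_def D_def
      using gradient_field_has_derivative[OF f p c] gradient_field_has_derivative[OF f p d] by auto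
    have tau: "(transition c d has_derivative \<tau>') (at (snd c p))"
      unfolding \<tau>'_def by (rule transition_has_derivative[OF N c d])
    have tau_p: "transition c d (snd c p) = snd d p"
      by (rule transition_apply[OF N c])
    have y0: "(y \<longlongrightarrow> snd c p) (at 0)"
      unfolding y_def by (auto intro!: tendsto_eq_intros)
    have Xc: "((\<lambda>s. X c (y s) /\<^sub>R s) \<longlongrightarrow> D c h) (at 0)"
      unfolding y_def by (rule directional_limit[OF DX(1) X_p(1)])
    have "((\<lambda>y. X d (transition c d y)) has_derivative (\<lambda>h. D d (\<tau>' h))) (at (snd c p))"
      using DX(2) tau_p by (intro has_derivative_compose[OF tau]) simp
    then have Xd: "((\<lambda>s. X d (transition c d (y s)) /\<^sub>R s) \<longlongrightarrow> D d (\<tau>' h)) (at 0)"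
      unfolding y_def by (rule directional_limit) (simp add: tau_p X_p)
    have tau_y: "((\<lambda>s. transition c d (y s)) \<longlongrightarrow> snd d p) (at 0)"
      using isCont_tendsto_compose[OF has_derivative_continuous[OF tau] y0] by (simp add: tau_p)
    have tau'_y: "((\<lambda>s. frechet_derivative (transition c d) (at (y s)) u) \<longlongrightarrow> \<tau>' u) (at 0)"
    proof -
      have "isCont (\<lambda>y. frechet_derivative (transition c d) (at y) u) (snd c p)"
        using smooth_on_continuous_derivative[OF smooth_on_transition(1)[OF N c d]]
          smooth_on_transition(2,3)[OF N c d] continuous_on_eq_continuous_at by blast
      from isCont_tendsto_compose[OF this y0] show ?thesis
        by (simp add: \<tau>'_def)
    qed
    note G = isCont_tendsto_compose[OF isCont_metric_blinfun[OF R]]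
    have lim_d: "((\<lambda>s. metric_blinfun N d (transition c d (y s)) (X d (transition c d (y s)) /\<^sub>R s)
          (frechet_derivative (transition c d) (at (y s)) u))
        \<longlongrightarrow> metric_blinfun N d (snd d p) (D d (\<tau>' h)) (\<tau>' u)) (at 0)"
      by (intro blinfun.tendsto G[OF at(2) im(2)] Xd tau_y tau'_y)
    have lim_c: "((\<lambda>s. metric_blinfun N c (y s) (X c (y s) /\<^sub>R s) u)
        \<longlongrightarrow> metric_blinfun N c (snd c p) (D c h) u) (at 0)"
      by (intro blinfun.tendsto G[OF at(1) im(1)] Xc y0 tendsto_const)
    have "metric_blinfun N c z (X c z) u = metric_blinfun N d (transition c d z) (X d (transition c d z))
          (frechet_derivative (transition c d) (at z) u)"
      if z: "z \<in> ?S" for z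
    proof -
      obtain q where q: "q \<in> fst c" "q \<in> fst d" "q \<in> U" "z = snd c q"
        using z by blast
      then have cq: "c \<in> charts_at N q" and dq: "d \<in> charts_at N q"
        using at by (auto simp: charts_at_def)
      have im_q: "z \<in> chart_image c" "transition c d z \<in> chart_image d"
        using q transition_apply[OF N cq] by auto
      have grad_q: "grad N f q \<in> tangent_space N q"
        by (rule gradient_in_chart(2)[OF R U f q(3) cq])
      then have "frechet_derivative (transition c d) (at (snd c q)) (grad N f q c) = grad N f q d"
        using cq dq unfolding tangent_space_def by fastforce
      then have "metric_in N c (snd c q) (grad N f q c) u = metric_in N d (snd d q) (grad N f q d)
          (frechet_derivative (transition c d) (at (snd c q)) u)"
        using metric_in_change_chart[OF N cq dq, of "grad N f q c" u] by simp
      then show ?thesis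
        using metric_blinfun_apply[OF R at(1) im_q(1)] metric_blinfun_apply[OF R at(2) im_q(2)]
        by (simp add: X_def q(4) transition_apply[OF N cq] chart_inv_chart[OF N cq] chart_inv_chart[OF N dq])
    qed
    moreover have "\<forall>\<^sub>F s in at 0. y s \<in> ?S"
    proof (rule topological_tendstoD[OF y0])
      show "open ?S"
        using open_chart_image_Int[OF N at(1)] openin_Int[OF openin_chart_domain[OF N at(2)] U] by blast
      show "snd c p \<in> ?S"
        using p c d by (auto simp: charts_at_def)
    qed
    ultimately have "\<forall>\<^sub>F s in at 0. metric_blinfun N c (y s) (X c (y s) /\<^sub>R s) u =
        metric_blinfun N d (transition c d (y s)) (X d (transition c d (y s)) /\<^sub>R s)
          (frechet_derivative (transition c d) (at (y s)) u)"
      by (auto elim!: eventually_mono simp: blinfun.scaleR_left blinfun.scaleR_right)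
    from Lim_transform_eventually[OF lim_c this]
    have "metric_blinfun N d (snd d p) (D d (\<tau>' h)) (\<tau>' u) = metric_blinfun N c (snd c p) (D c h) u"
      using lim_d by (intro tendsto_unique[of "at (0::real)"]) auto
    then show ?thesis
      using metric_blinfun_apply[OF R] at im by metis
  qed
  show ?thesis
  proof (rule metric_in_nondegenerate[OF R at(2) im(2)])
    fix v
    define u where "u = frechet_derivative (transition d c) (at (snd d p)) v"
    have "\<tau>' u = v"
      unfolding \<tau>'_def u_def
      using transition_derivative_comp[OF N d c d] transition_derivative_self[OF N d] by metis
    then show "metric_in N d (snd d p) (D d (\<tau>' h)) v = metric_in N d (snd d p) (\<tau>' (D c h)) v"
      using weak[of u] metric_in_change_chart[OF N c d, of "D c h" u] by (simp add: \<tau>'_def)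
  qed
qed

lemma Hess_in_tangent_space:
  assumes R: "riemannian_manifold N" and LC: "levi_civita N \<Gamma>"
    and U: "openin (mtop N) U" and f: "has_grad_and_Hess_on N f U"
    and p: "p \<in> U" and crit: "grad N f p = tzero" and h: "h \<in> tangent_space N p"
  shows "Hess N \<Gamma> f p h \<in> tangent_space N p"
proof -
  have "Hess N \<Gamma> f p h d = frechet_derivative (transition c d) (at (snd c p)) (Hess N \<Gamma> f p h c)"
    if c: "c \<in> charts_at N p" and d: "d \<in> charts_at N p" for c d
  proof -
    have "h d = frechet_derivative (transition c d) (at (snd c p)) (h c)"
      using h c d unfolding tangent_space_def by blast
    then show ?thesis
      using gradient_derivative_change_chart[OF R U f p crit c d, of "h c"]
        Hess_component[where N = N and f = f and h = h, OF LC _ crit] c d by metis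
  qed
  moreover have "Hess N \<Gamma> f p h c = 0" if "c \<notin> charts_at N p" for c
    using that by (simp add: Hess_def nabla_def)
  ultimately show ?thesis
    unfolding tangent_space_def by blast
qed

lemma Hess_form_in_chart:
  assumes R: "riemannian_manifold N" and LC: "levi_civita N \<Gamma>"
    and U: "openin (mtop N) U" and f: "has_grad_and_Hess_on N f U"
    and p: "p \<in> U" and crit: "grad N f p = tzero" and c: "c \<in> charts_at N p"
  shows "metric N p (Hess N \<Gamma> f p (tangent_of N c p u)) (tangent_of N c p v) =
    metric_blinfun N c (snd c p)
      (frechet_derivative (\<lambda>y. grad N f (chart_inv c y) c) (at (snd c p)) u) v"
proof -
  have N: "smooth_manifold N"
    using R unfolding riemannian_manifold_def by blast
  note T = tangent_of_in_tangent_space[OF N c] and comp = tangent_of_component[OF N c]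
  have "Hess N \<Gamma> f p (tangent_of N c p u) c =
      frechet_derivative (\<lambda>y. grad N f (chart_inv c y) c) (at (snd c p)) u"
    using Hess_component[OF LC c crit, of "tangent_of N c p u"] by (simp add: comp)
  moreover have "c \<in> atlas N" "snd c p \<in> chart_image c"
    using c by (auto simp: charts_at_def)
  ultimately show ?thesis
    using metric_in_tangent_space[OF N c Hess_in_tangent_space[OF R LC U f p crit T] T, of u v]
    by (simp add: comp metric_blinfun_apply[OF R])
qed

lemma critical_point_expansion:
  assumes R: "riemannian_manifold N" and LC: "levi_civita N \<Gamma>"
    and U: "openin (mtop N) U" and f: "has_grad_and_Hess_on N f U"
    and p: "p \<in> U" and crit: "grad N f p = tzero" and c: "c \<in> charts_at N p" and e: "e > 0"
  shows "\<exists>\<delta>>0. \<forall>u. norm u < \<delta> \<longrightarrow> snd c p + u \<in> snd c ` (fst c \<inter> U) \<and>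
    \<bar>f (chart_inv c (snd c p + u)) - f p -
      metric N p (Hess N \<Gamma> f p (tangent_of N c p u)) (tangent_of N c p u) / 2\<bar> \<le> e * (norm u)\<^sup>2"
proof -
  have N: "smooth_manifold N"
    using R unfolding riemannian_manifold_def by blast
  have at: "c \<in> atlas N" and im: "snd c p \<in> chart_image c"
    using c by (auto simp: charts_at_def)
  define F where "F = f \<circ> chart_inv c"
  define X where "X y = grad N f (chart_inv c y) c" for y
  define D where "D = frechet_derivative X (at (snd c p))"
  define A where "A y = metric_blinfun N c y (X y)" for y
  define B where "B h = metric_blinfun N c (snd c p) (D h)" for h
  have X_p: "X (snd c p) = 0"
    using crit by (simp add: X_def chart_inv_chart[OF N c] tzero_def)
  have DX: "(X has_derivative D) (at (snd c p))"
    using gradient_field_has_derivative[OF f p c] unfolding X_def D_def .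
  have F: "(F has_derivative A y) (at y)" if y: "y \<in> snd c ` (fst c \<inter> U)" for y
  proof -
    obtain q where q: "q \<in> fst c" "q \<in> U" "y = snd c q"
      using y by blast
    then have "c \<in> charts_at N q"
      using at by (simp add: charts_at_def)
    from gradient_in_chart(1)[OF R U f q(2) this] show ?thesis
      by (simp add: F_def A_def X_def q(3) chart_inv_chart[OF N \<open>c \<in> charts_at N q\<close>])
  qed
  have "metric_blinfun N c differentiable (at (snd c p))"
    using R at im unfolding riemannian_manifold_def metric_blinfun_def[abs_def]
    by (blast intro: smooth_on_differentiable)
  then have A: "(A has_derivative B) (at (snd c p))"
    using blinfun.FDERIV[OF _ DX] unfolding frechet_derivative_works A_def B_def
    by (fastforce simp: X_p)
  obtain \<delta> where \<delta>: "\<delta> > 0" "\<And>u. norm u < \<delta> \<Longrightarrow> snd c p + u \<in> snd c ` (fst c \<inter> U) \<and>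
      \<bar>F (snd c p + u) - F (snd c p) - A (snd c p) u - B u u / 2\<bar> \<le> e * (norm u)\<^sup>2"
    using second_order_expansion[OF open_chart_image_Int[OF N at U] _ F A e] p c
    by (auto simp: charts_at_def)
  have "B u u = metric N p (Hess N \<Gamma> f p (tangent_of N c p u)) (tangent_of N c p u)" for u
    unfolding Hess_form_in_chart[OF R LC U f p crit c] by (simp add: B_def D_def X_def[abs_def])
  then show ?thesis
    using \<delta> by (intro exI[of _ \<delta>]) (simp add: F_def A_def X_p chart_inv_chart[OF N c])
qed

lemma grad_zero_if_optimal:
  assumes R: "riemannian_manifold N" and U: "openin (mtop N) U" and f: "has_grad_and_Hess_on N f U"
    and opt: "optimal_solution f U p"
  shows "grad N f p = tzero"
proof -
  have N: "smooth_manifold N"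
    using R unfolding riemannian_manifold_def by blast
  have p: "p \<in> U" and min: "\<And>q. q \<in> U \<Longrightarrow> f p \<le> f q"
    using opt unfolding optimal_solution_def by auto
  obtain c where c: "c \<in> charts_at N p"
    using p N openin_subset[OF U] unfolding smooth_manifold_def charts_at_def by auto
  have at: "c \<in> atlas N" and im: "snd c p \<in> chart_image c"
    using c by (auto simp: charts_at_def)
  have "metric_blinfun N c (snd c p) (grad N f p c) u = 0" for u
  proof -
    have "blinfun_apply (metric_blinfun N c (snd c p) (grad N f p c)) = (\<lambda>u. 0)"
    proof (rule differential_zero_maxmin)
      show "((f \<circ> chart_inv c) has_derivative metric_blinfun N c (snd c p) (grad N f p c)) (at (snd c p))"
        by (rule gradient_in_chart(1)[OF R U f p c])
      show "open (snd c ` (fst c \<inter> U))"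
        by (rule open_chart_image_Int[OF N at U])
      show "snd c p \<in> snd c ` (fst c \<inter> U)"
        using p c by (auto simp: charts_at_def)
      have "(f \<circ> chart_inv c) (snd c p) \<le> (f \<circ> chart_inv c) y" if "y \<in> snd c ` (fst c \<inter> U)" for y
        using that min inj_on_chart[OF N at] by (auto simp: chart_inv_chart[OF N c])
      then show "(\<forall>y\<in>snd c ` (fst c \<inter> U). (f \<circ> chart_inv c) y \<le> (f \<circ> chart_inv c) (snd c p)) \<or>
          (\<forall>y\<in>snd c ` (fst c \<inter> U). (f \<circ> chart_inv c) (snd c p) \<le> (f \<circ> chart_inv c) y)"
        by blast
    qed
    then show ?thesis
      by metis
  qed
  then have "metric_in N c (snd c p) (grad N f p c) u = metric_in N c (snd c p) 0 u" for u
    using metric_blinfun_apply[OF R at im] by (metis blinfun.zero_left blinfun.zero_right)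
  then have "grad N f p c = 0"
    by (rule metric_in_nondegenerate[OF R at im])
  then show ?thesis
    using tangent_of_eq[OF gradient_in_chart(2)[OF R U f p c] c] tangent_of_zero[OF N c] by simp
qed

theorem theorem2p5:
  fixes N :: "('m, 'e::{real_inner, complete_space}) riemannian"
    and \<Gamma> :: "('m, 'e) christoffel"
    and U :: "'m set" and f :: "'m \<Rightarrow> real" and xh :: 'm
  assumes "riemannian_manifold N"
    and "levi_civita N \<Gamma>"
    and "openin (mtop N) U"
    and "geodesically_convex N \<Gamma> U"
    and "has_grad_and_Hess_on N f U"
    and "xh \<in> U"
    and "Hess_lipschitz_at N \<Gamma> f U xh"
  shows "(optimal_solution f U xh \<longrightarrow>
            (\<forall>h\<in>tangent_space N xh. 0 \<le> metric N xh (Hess N \<Gamma> f xh h) h)) \<and>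
         (grad N f xh = tzero \<longrightarrow>
            (\<exists>c>0. \<forall>h\<in>tangent_space N xh.
               c * (tnorm N xh h)\<^sup>2 \<le> metric N xh (Hess N \<Gamma> f xh h) h) \<longrightarrow>
            local_minimum N f U xh)"
proof -
  have N: "smooth_manifold N"
    using assms(1) unfolding riemannian_manifold_def by blast
  obtain c where c: "c \<in> charts_at N xh"
    using N assms(6) openin_subset[OF assms(3)] unfolding smooth_manifold_def charts_at_def by auto
  then have at: "c \<in> atlas N" and im: "snd c xh \<in> chart_image c"
    by (auto simp: charts_at_def)
  define Q where "Q u = metric N xh (Hess N \<Gamma> f xh (tangent_of N c xh u)) (tangent_of N c xh u)" for u
  have expansion: "\<exists>\<delta>>0. \<forall>u. norm u < \<delta> \<longrightarrow> snd c xh + u \<in> snd c ` (fst c \<inter> U) \<and>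
      \<bar>f (chart_inv c (snd c xh + u)) - f xh - Q u / 2\<bar> \<le> e * (norm u)\<^sup>2"
    if "grad N f xh = tzero" "e > 0" for e
    unfolding Q_def using critical_point_expansion[OF assms(1,2,3,5,6) that(1) c that(2)] .
  show ?thesis
  proof (intro conjI impI ballI)
    fix h
    assume opt: "optimal_solution f U xh" and h: "h \<in> tangent_space N xh"
    have crit: "grad N f xh = tzero"
      by (rule grad_zero_if_optimal[OF assms(1,3,5) opt])
    define u where "u = h c"
    have u: "tangent_of N c xh u = h"
      unfolding u_def by (rule tangent_of_eq[OF h c])
    have "linear (frechet_derivative (\<lambda>y. grad N f (chart_inv c y) c) (at (snd c xh)))"
      using gradient_field_has_derivative[OF assms(5,6) c] by (rule has_derivative_linear)
    then have Q_scale: "Q (s *\<^sub>R u) = s\<^sup>2 * Q u" for s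
      unfolding Q_def Hess_form_in_chart[OF assms(1,2,3,5,6) crit c]
      by (simp add: linear_cmul blinfun.scaleR_left blinfun.scaleR_right power2_eq_square)
    have "0 \<le> Q u + e" if e: "e > 0" for e
    proof -
      define n where "n = (norm u)\<^sup>2 + 1"
      have n: "n > 0"
        unfolding n_def by (intro add_nonneg_pos) auto
      define e' where "e' = e / (2 * n)"
      have e': "e' > 0"
        unfolding e'_def using e n by simp
      have "2 * e' * (norm u)\<^sup>2 \<le> 2 * e' * n"
        using e' by (simp add: n_def)
      also have "\<dots> = e"
        using n by (simp add: e'_def)
      finally have e'_le: "2 * e' * (norm u)\<^sup>2 \<le> e" .
      obtain \<delta> where \<delta>: "\<delta> > 0" "\<And>v. norm v < \<delta> \<Longrightarrow> snd c xh + v \<in> snd c ` (fst c \<inter> U)"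
          "\<And>v. norm v < \<delta> \<Longrightarrow> \<bar>f (chart_inv c (snd c xh + v)) - f xh - Q v / 2\<bar> \<le> e' * (norm v)\<^sup>2"
        using expansion[OF crit e'] by blast
      define s where "s = \<delta> / (norm u + 1)"
      have s: "s > 0"
        unfolding s_def using \<delta>(1) by (intro divide_pos_pos) (auto intro: add_nonneg_pos)
      have "norm (s *\<^sub>R u) = \<delta> * (norm u / (norm u + 1))"
        using \<delta>(1) by (simp add: s_def)
      also have "\<dots> < \<delta> * 1"
        using \<delta>(1) by (intro mult_strict_left_mono) (auto simp: divide_less_eq add_nonneg_pos)
      finally have su: "norm (s *\<^sub>R u) < \<delta>"
        by simp
      obtain q where q: "q \<in> fst c" "q \<in> U" "snd c xh + s *\<^sub>R u = snd c q"
        using \<delta>(2)[OF su] by blast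
      have "f xh \<le> f (chart_inv c (snd c xh + s *\<^sub>R u))"
        using opt q inj_on_chart[OF N at] by (simp add: optimal_solution_def)
      then have "0 \<le> Q (s *\<^sub>R u) / 2 + e' * (norm (s *\<^sub>R u))\<^sup>2"
        using \<delta>(3)[OF su] by linarith
      also have "\<dots> = s\<^sup>2 / 2 * (Q u + 2 * e' * (norm u)\<^sup>2)"
        by (simp add: Q_scale power_mult_distrib algebra_simps)
      finally have "0 \<le> Q u + 2 * e' * (norm u)\<^sup>2"
        using s by (simp add: zero_le_mult_iff)
      with e'_le show ?thesis
        by linarith
    qed
    then have "0 \<le> Q u"
      by (rule field_le_epsilon)
    then show "0 \<le> metric N xh (Hess N \<Gamma> f xh h) h"
      by (simp add: Q_def u)
  next
    assume crit: "grad N f xh = tzero"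
      and "\<exists>c>0. \<forall>h\<in>tangent_space N xh. c * (tnorm N xh h)\<^sup>2 \<le> metric N xh (Hess N \<Gamma> f xh h) h"
    then obtain a where a: "a > 0"
        "\<And>h. h \<in> tangent_space N xh \<Longrightarrow> a * (tnorm N xh h)\<^sup>2 \<le> metric N xh (Hess N \<Gamma> f xh h) h"
      by blast
    obtain k where k: "k > 0" "\<And>u. k * (norm u)\<^sup>2 \<le> metric_in N c (snd c xh) u u"
      using assms(1) at im unfolding riemannian_manifold_def by blast
    have Q: "a * k * (norm u)\<^sup>2 \<le> Q u" for u
    proof -
      have le: "k * (norm u)\<^sup>2 \<le> metric N xh (tangent_of N c xh u) (tangent_of N c xh u)"
        using k(2) by (simp add: metric_in_chart[OF N c])
      moreover have "0 \<le> k * (norm u)\<^sup>2"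
        using k(1) by simp
      ultimately have "k * (norm u)\<^sup>2 \<le> (tnorm N xh (tangent_of N c xh u))\<^sup>2"
        unfolding tnorm_def by simp
      then have "a * (k * (norm u)\<^sup>2) \<le> a * (tnorm N xh (tangent_of N c xh u))\<^sup>2"
        using a(1) by simp
      also have "\<dots> \<le> Q u"
        unfolding Q_def by (rule a(2)[OF tangent_of_in_tangent_space[OF N c]])
      finally show ?thesis
        by (simp add: mult.assoc)
    qed
    obtain \<delta> where \<delta>: "\<delta> > 0" "\<And>u. norm u < \<delta> \<Longrightarrow>
        \<bar>f (chart_inv c (snd c xh + u)) - f xh - Q u / 2\<bar> \<le> a * k / 2 * (norm u)\<^sup>2"
      using expansion[OF crit, of "a * k / 2"] a(1) k(1) by auto
    define W where "W = {x \<in> fst c. snd c x \<in> ball (snd c xh) \<delta>}"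
    have "openin (mtop N) W"
      unfolding W_def by (rule openin_chart_vimage[OF N at open_ball])
    moreover have "xh \<in> W"
      using c \<delta>(1) by (simp add: W_def charts_at_def)
    moreover have "f xh \<le> f x" if "x \<in> W" for x
    proof -
      have x: "c \<in> charts_at N x" "norm (snd c x - snd c xh) < \<delta>"
        using that at by (auto simp: W_def charts_at_def dist_norm norm_minus_commute)
      have "\<bar>f x - f xh - Q (snd c x - snd c xh) / 2\<bar> \<le> a * k / 2 * (norm (snd c x - snd c xh))\<^sup>2"
        using \<delta>(2)[OF x(2)] chart_inv_chart[OF N x(1)] by simp
      with Q[of "snd c x - snd c xh"] show ?thesis
        by (simp only: times_divide_eq_left)
    qed
    ultimately show "local_minimum N f U xh"
      using assms(6) unfolding local_minimum_def by blast
  qed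
qed

end
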